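(* Let $(X,\|\cdot\|_n)$ and $(Y,|\cdot|_n)$ be Fréchet spaces and let $F:X\rightrightarrows Y$ be a multi-valued map with closed graph. Let $U\subset X$ be open and let $V\subset Y$ be open and convex. Assume that for some $\kappa>0$ $$D'F(x,y)(\Pi_{\mathbf{s}}(X))\supset\kappa\Pi_{\mathbf{s}}(Y),\quad\forall (x,y)\in(U\times V)\cap\mathrm{Gr}\,F,\ \forall\mathbf{s}\in\mathbb{R}_+^\infty.$$ Then $F$ is weakly $\Pi$-surjective on $(U,V)$ with constant $\kappa$. If, moreover, $\Pi_{\mathbf{s}}(X)$ is compact for all $\mathbf{s}\in\mathbb{R}_+^\infty$, then $F$ is $\Pi$-surjective on $(U,V)$ with constant $\kappa$.
   Context: A Fréchet space $(X,\|\cdot\|_n)$ is a linear space $X$ with a fixed collection of seminorms $\|\cdot\|_n$, $n=0,1,2,\ldots$, which is separating ($\|x\|_n=0$ for all $n$ iff $x=0$) and such that $X$ is complete in the metric $$\rho_X(x,y):=\max_{n\ge 0}\frac{2^{-n}\|x-y\|_n}{1+\|x-y\|_n}.$$ Topological notions in $X$ refer to $\rho_X$; similarly for $Y$ with $\rho_Y$ built from $|\cdot|_n$. $\mathbb{R}_+^\infty:=\{(s_i)_{i=0}^\infty:\ s_i\ge 0\}$; for $\mathbf{s}\in\mathbb{R}_+^\infty$, $\Pi_{\mathbf{s}}(X):=\{x\in X:\ \|x\|_n\le s_n,\ \forall n\ge 0\}$ and $\Pi_{\mathbf{s}}(Y):=\{y\in Y:\ |y|_n\le s_n,\ \forall n\ge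 0\}$. For a multi-valued map $F$ (values are subsets of $Y$, possibly empty), $\mathrm{Gr}\,F:=\{(x,y):\ y\in F(x)\}$ and $F(A):=\bigcup_{a\in A}F(a)$; $\mathrm{cl}$ denotes closure. For $(x,y)\in\mathrm{Gr}\,F$ and a non-empty set $A\subset X$, the set $D'F(x,y)(A)\subset Y$ is defined by $$v\in D'F(x,y)(A)\iff \exists\, t_n\downarrow 0:\ \lim_{n\to\infty}\frac{\inf\rho_Y(F(x+t_nA),\,y+t_nv)}{t_n}=0,$$ where $\inf\rho_Y(B,z):=\inf_{b\in B}\rho_Y(b,z)$ (with $\inf\emptyset=+\infty$). $F$ is $\Pi$-surjective on $(U,V)$ with constant $\kappa>0$ if whenever $(x,y)\in(U\times V)\cap\mathrm{Gr}\,F$ and $\mathbf{s}\in\mathbb{R}_+^\infty$ are such that $x+\Pi_{\mathbf{s}}(X)\subset U$, it holds that $F(x+\Pi_{\mathbf{s}}(X))\supset\{y+\kappa\Pi_{\mathbf{s}}(Y)\}\cap V$. $F$ is weakly $\Pi$-surjective on $(U,V)$ with constant $\kappa>0$ if, under the same conditions on $(x,y)$ and $\mathbf{s}$, it holds that $\mathrm{cl}\,F(x+\Pi_{\mathbf{s}}(X))\supset\{y+\kappa\Pi_{\mathbf{s}}(Y)\}\cap V$. *)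

theory Defs
  imports "HOL-Analysis.Analysis"
begin

definition seminorm :: "('a::real_vector \<Rightarrow> real) \<Rightarrow> bool" where
  "seminorm p \<longleftrightarrow>
    (\<forall>x. 0 \<le> p x) \<and> (\<forall>x y. p (x + y) \<le> p x + p y) \<and> (\<forall>c x. p (c *\<^sub>R x) = \<bar>c\<bar> * p x)"

(* The supremum is a maximum when every p n is a seminorm: see rho_attained below. *)
definition rho :: "(nat \<Rightarrow> 'a::real_vector \<Rightarrow> real) \<Rightarrow> 'a \<Rightarrow> 'a \<Rightarrow> real" where
  "rho p x y = (SUP n. (1/2) ^ n * p n (x - y) / (1 + p n (x - y)))"

locale separating_seminorms =
  fixes p :: "nat \<Rightarrow> 'a::real_vector \<Rightarrow> real"
  assumes seminorm: "\<And>n. seminorm (p n)"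
    and separating: "\<And>x. (\<forall>n. p n x = 0) \<longleftrightarrow> x = 0"
begin

lemma nonneg: "0 \<le> p n x"
  using seminorm[of n] by (simp add: seminorm_def)

lemma triangle: "p n (x + y) \<le> p n x + p n y"
  using seminorm[of n] by (simp add: seminorm_def)

lemma scale: "p n (c *\<^sub>R x) = \<bar>c\<bar> * p n x"
  using seminorm[of n] by (simp add: seminorm_def)

lemma minus_commute: "p n (x - y) = p n (y - x)"
  using scale[of n "-1" "x - y"] by simp

lemma rho_term_nonneg: "0 \<le> (1/2) ^ n * p n z / (1 + p n z)"
  using nonneg[of n z] by simp

lemma rho_term_le: "(1/2) ^ n * p n z / (1 + p n z) \<le> (1/2) ^ n"
  using nonneg[of n z] by (simp add: divide_simps)

lemma rho_bdd: "bdd_above (range (\<lambda>n. (1/2) ^ n * p n z / (1 + p n z)))"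
proof (rule bdd_aboveI2)
  fix n
  have "(1/2::real) ^ n \<le> 1" by (simp add: power_le_one)
  then show "(1/2) ^ n * p n z / (1 + p n z) \<le> 1"
    using rho_term_le[of n z] by linarith
qed

lemma rho_ge: "(1/2) ^ n * p n (x - y) / (1 + p n (x - y)) \<le> rho p x y"
  unfolding rho_def by (rule cSUP_upper[OF _ rho_bdd]) simp

lemma rho_attained:
  "\<exists>m. rho p x y = (1/2) ^ m * p m (x - y) / (1 + p m (x - y))"
proof -
  define a where "a n = (1/2) ^ n * p n (x - y) / (1 + p n (x - y))" for n
  have a0: "0 \<le> a n" for n unfolding a_def by (rule rho_term_nonneg)
  have "\<exists>m. \<forall>n. a n \<le> a m"
  proof (cases "\<exists>k. 0 < a k")
    case True
    then obtain k where k: "0 < a k" by blast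
    obtain N where N: "(1/2::real) ^ N < a k"
      using real_arch_pow_inv[OF k, of "1/2"] by auto
    have small: "a n < a k" if "N \<le> n" for n
    proof -
      have "a n \<le> (1/2) ^ n" unfolding a_def by (rule rho_term_le)
      also have "\<dots> \<le> (1/2) ^ N" using that by (intro power_decreasing) auto
      finally show ?thesis using N by simp
    qed
    have "Max (a ` {..N}) \<in> a ` {..N}" by (rule Max_in) auto
    then obtain m where m: "a m = Max (a ` {..N})" by (metis imageE)
    have le: "a n \<le> a m" if "n \<le> N" for n
      unfolding m using that by (intro Max_ge) auto
    have "k < N" using small[of k] by (meson less_irrefl not_le)
    then have "a n \<le> a m" for n
      using le[of n] le[of k] small[of n] by (cases "n \<le> N") auto
    then show ?thesis by blast
  next
    case False
    then show ?thesis using a0 by (intro exI[of _ 0]) (meson not_le order_trans)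
  qed
  then obtain m where m: "\<And>n. a n \<le> a m" by blast
  have "(SUP n. a n) = a m"
    by (rule cSup_eq_maximum) (use m in auto)
  then show ?thesis unfolding rho_def a_def by blast
qed

lemma metric_rho: "Metric_space UNIV (rho p)"
proof
  fix x y z :: 'a
  show "0 \<le> rho p x y"
    using rho_attained[of x y] rho_term_nonneg by auto
  show "rho p x y = rho p y x"
    unfolding rho_def by (simp add: minus_commute)
  show "rho p x y = 0 \<longleftrightarrow> x = y"
  proof
    assume 0: "rho p x y = 0"
    have "p n (x - y) = 0" for n
    proof -
      have "(1/2) ^ n * p n (x - y) / (1 + p n (x - y)) = 0"
        using rho_ge[of n x y] rho_term_nonneg[of n "x - y"] 0 by linarith
      then show ?thesis using nonneg[of n "x - y"] by auto
    qed
    then show "x = y" using separating[of "x - y"] by simp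
  next
    assume "x = y"
    then show "rho p x y = 0"
      using rho_attained[of x y] separating[of "0::'a"] by auto
  qed
  show "rho p x z \<le> rho p x y + rho p y z"
  proof -
    obtain m where m: "rho p x z = (1/2) ^ m * p m (x - z) / (1 + p m (x - z))"
      using rho_attained by blast
    define a b c where "a = p m (x - z)" and "b = p m (x - y)" and "c = p m (y - z)"
    have nn: "0 \<le> a" "0 \<le> b" "0 \<le> c" unfolding a_def b_def c_def by (auto simp: nonneg)
    have abc: "a \<le> b + c"
      unfolding a_def b_def c_def using triangle[of m "x - y" "y - z"] by simp
    have "a / (1 + a) \<le> (b + c) / (1 + (b + c))"
      using nn abc by (simp add: divide_simps) (simp add: algebra_simps)
    also have "\<dots> = b / (1 + (b + c)) + c / (1 + (b + c))" by (rule add_divide_distrib)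
    also have "\<dots> \<le> b / (1 + b) + c / (1 + c)"
      using nn by (intro add_mono divide_left_mono) auto
    finally have "(1/2) ^ m * (a / (1 + a)) \<le> (1/2) ^ m * (b / (1 + b) + c / (1 + c))"
      by (intro mult_left_mono) auto
    then show ?thesis
      using rho_ge[of m x y] rho_ge[of m y z]
      unfolding m a_def b_def c_def by (simp add: algebra_simps)
  qed
qed

end

locale frechet_space = separating_seminorms p
  for p :: "nat \<Rightarrow> 'a::real_vector \<Rightarrow> real" +
  assumes complete: "Metric_space.mcomplete UNIV (rho p)"

abbreviation frechet_topology :: "(nat \<Rightarrow> 'a::real_vector \<Rightarrow> real) \<Rightarrow> 'a topology" where
  "frechet_topology p \<equiv> Metric_space.mtopology UNIV (rho p)"

definition nonneg_seqs :: "(nat \<Rightarrow> real) set" where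
  "nonneg_seqs = {s. \<forall>i. 0 \<le> s i}"

definition Pi_box :: "(nat \<Rightarrow> 'a::real_vector \<Rightarrow> real) \<Rightarrow> (nat \<Rightarrow> real) \<Rightarrow> 'a set" where
  "Pi_box p s = {x. \<forall>n. p n x \<le> s n}"

definition Gr :: "('a \<Rightarrow> 'b set) \<Rightarrow> ('a \<times> 'b) set" where
  "Gr F = {(x, y). y \<in> F x}"

definition image_mv :: "('a \<Rightarrow> 'b set) \<Rightarrow> 'a set \<Rightarrow> 'b set" where
  "image_mv F A = (\<Union>a\<in>A. F a)"

(* Extended-real valued, so that the infimum over the empty set is infinity. *)
definition inf_rho :: "(nat \<Rightarrow> 'b::real_vector \<Rightarrow> real) \<Rightarrow> 'b set \<Rightarrow> 'b \<Rightarrow> ereal" where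
  "inf_rho q B z = (INF b\<in>B. ereal (rho q b z))"

(* Used only for (x, y) in Gr F and non-empty A. *)
definition D' :: "(nat \<Rightarrow> 'b::real_vector \<Rightarrow> real) \<Rightarrow> ('a::real_vector \<Rightarrow> 'b set) \<Rightarrow>
    'a \<Rightarrow> 'b \<Rightarrow> 'a set \<Rightarrow> 'b set" where
  "D' q F x y A = {v. \<exists>t :: nat \<Rightarrow> real.
      (\<forall>n. 0 < t n) \<and> decseq t \<and> t \<longlonglongrightarrow> 0 \<and>
      (\<lambda>n. inf_rho q (image_mv F ((\<lambda>a. x + t n *\<^sub>R a) ` A)) (y + t n *\<^sub>R v) / ereal (t n))
        \<longlonglongrightarrow> 0}"

definition Pi_surjective ::
    "(nat \<Rightarrow> 'a::real_vector \<Rightarrow> real) \<Rightarrow> (nat \<Rightarrow> 'b::real_vector \<Rightarrow> real) \<Rightarrow>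
     ('a \<Rightarrow> 'b set) \<Rightarrow> 'a set \<Rightarrow> 'b set \<Rightarrow> real \<Rightarrow> bool" where
  "Pi_surjective p q F U V \<kappa> \<longleftrightarrow> 0 < \<kappa> \<and>
    (\<forall>x y. \<forall>s\<in>nonneg_seqs.
       (x, y) \<in> (U \<times> V) \<inter> Gr F \<and> (\<lambda>a. x + a) ` Pi_box p s \<subseteq> U \<longrightarrow>
       (\<lambda>v. y + \<kappa> *\<^sub>R v) ` Pi_box q s \<inter> V
         \<subseteq> image_mv F ((\<lambda>a. x + a) ` Pi_box p s))"

definition weakly_Pi_surjective ::
    "(nat \<Rightarrow> 'a::real_vector \<Rightarrow> real) \<Rightarrow> (nat \<Rightarrow> 'b::real_vector \<Rightarrow> real) \<Rightarrow>
     ('a \<Rightarrow> 'b set) \<Rightarrow> 'a set \<Rightarrow> 'b set \<Rightarrow> real \<Rightarrow> bool" where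
  "weakly_Pi_surjective p q F U V \<kappa> \<longleftrightarrow> 0 < \<kappa> \<and>
    (\<forall>x y. \<forall>s\<in>nonneg_seqs.
       (x, y) \<in> (U \<times> V) \<inter> Gr F \<and> (\<lambda>a. x + a) ` Pi_box p s \<subseteq> U \<longrightarrow>
       (\<lambda>v. y + \<kappa> *\<^sub>R v) ` Pi_box q s \<inter> V
         \<subseteq> frechet_topology q closure_of image_mv F ((\<lambda>a. x + a) ` Pi_box p s))"

end

theory Submission
  imports Defs
begin

text \<open>
  Let \<open>z = y + w\<close> with \<open>w \<in> \<kappa> \<Pi>\<^sub>s(Y)\<close> and fix \<open>\<epsilon> > 0\<close>. Travel along the segment from \<open>y\<close> to \<open>z\<close>:
  a state is a time \<open>\<tau> \<in> [0, 1]\<close> with a point \<open>(x', y')\<close> of the graph such that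
  \<open>x' \<in> x + \<tau> \<Pi>\<^sub>s(X)\<close> and \<open>\<rho>(y', y + \<tau> w) \<le> \<epsilon> \<tau>\<close>. For small \<open>\<epsilon>\<close> the points \<open>y'\<close> stay in \<open>V\<close>,
  because the segment is compact, so the derivative condition allows a step forward from every
  state with \<open>\<tau> < 1\<close>. Increasing sequences of states are Cauchy and their limits are again
  states, so the Brezis--Browder ordering principle yields a state with \<open>\<tau> = 1\<close>, that is, a point
  of \<open>F(x + \<Pi>\<^sub>s(X))\<close> within \<open>\<epsilon>\<close> of \<open>z\<close>.
\<close>

section \<open>The Brezis-Browder ordering principle\<close>

text \<open>Iterate a greedy choice: every \<open>a\<close> gets a successor \<open>g a\<close> that
  raises \<open>h\<close> at least halfway to its supremum over the successors of \<open>a\<close>.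
  An upper bound \<open>b\<close> of the iterates then has \<open>h b = B\<close>: otherwise some
  \<open>c\<close> above \<open>b\<close> with \<open>h c > h b\<close> would be a successor of
  every iterate, and the halfway condition would keep \<open>h c\<close> at or below the limit of
  \<open>h\<close> along the iterates.\<close>

lemma brezis_browder:
  fixes R :: "'c \<Rightarrow> 'c \<Rightarrow> bool" and h :: "'c \<Rightarrow> real"
  assumes refl: "\<And>a. a \<in> S \<Longrightarrow> R a a"
    and trans: "\<And>a b c. R a b \<Longrightarrow> R b c \<Longrightarrow> R a c"
    and mono: "\<And>a b. R a b \<Longrightarrow> h a \<le> h b"
    and bound: "\<And>a. a \<in> S \<Longrightarrow> h a \<le> B"
    and upper: "\<And>f :: nat \<Rightarrow> 'c. (\<And>n. f n \<in> S) \<Longrightarrow> (\<And>n. R (f n) (f (Suc n))) \<Longrightarrow>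
                  \<exists>b\<in>S. \<forall>n. R (f n) b"
    and incr: "\<And>a. a \<in> S \<Longrightarrow> h a < B \<Longrightarrow> \<exists>b\<in>S. R a b \<and> h a < h b"
    and start: "a0 \<in> S"
  shows "\<exists>b\<in>S. h b = B"
proof -
  \<comment> \<open>The halfway condition is written without the supremum \<open>M\<close>:
    \<open>h b\<close> is at least \<open>(h a + h c) / 2\<close> for every successor
    \<open>c\<close>. If \<open>h a = M\<close>, then \<open>a\<close> itself serves.\<close>
  have "\<exists>b\<in>S. R a b \<and> (\<forall>c\<in>S. R a c \<longrightarrow> h c \<le> 2 * h b - h a)" if a: "a \<in> S" for a
  proof -
    let ?H = "h ` {c\<in>S. R a c}"
    define M where "M = Sup ?H"
    have bdd: "bdd_above ?H" using bound by (intro bdd_aboveI2) auto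
    have le: "h c \<le> M" if "c \<in> S" "R a c" for c
      unfolding M_def using that bdd by (intro cSup_upper) auto
    show ?thesis
    proof (cases "h a = M")
      case True
      then show ?thesis using a refl[OF a] le by force
    next
      case False
      then have "(M + h a) / 2 < M" using le[OF a refl[OF a]] by simp
      then obtain b where "b \<in> S" "R a b" "(M + h a) / 2 < h b"
        using less_cSup_iff[OF _ bdd] a refl[OF a] unfolding M_def by blast
      then show ?thesis using le by (intro bexI[of _ b]) (auto, fastforce)
    qed
  qed
  then obtain g where g: "\<And>a. a \<in> S \<Longrightarrow> g a \<in> S" "\<And>a. a \<in> S \<Longrightarrow> R a (g a)"
    "\<And>a c. a \<in> S \<Longrightarrow> c \<in> S \<Longrightarrow> R a c \<Longrightarrow> h c \<le> 2 * h (g a) - h a"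
    by metis
  define f where "f n = (g ^^ n) a0" for n
  have fS: "f n \<in> S" for n unfolding f_def by (induction n) (auto simp: g start)
  have f_Suc: "f (Suc n) = g (f n)" for n by (simp add: f_def)
  obtain b where b: "b \<in> S" "\<And>n. R (f n) b"
    using upper[of f] fS g(2) f_Suc by metis
  have "\<not> h b < B"
  proof
    assume "h b < B"
    then obtain c where c: "c \<in> S" "R b c" "h b < h c" using incr b(1) by blast
    have "incseq (\<lambda>n. h (f n))"
      by (intro incseq_SucI mono) (simp add: f_Suc g fS)
    moreover have hb: "h (f n) \<le> h b" for n by (rule mono[OF b(2)])
    ultimately obtain L where L: "(\<lambda>n. h (f n)) \<longlonglongrightarrow> L"
      using incseq_convergent by blast
    \<comment> \<open>Both values of \<open>h\<close> on the right tend to \<open>L\<close>, so the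
      bound on \<open>h c\<close> collapses to \<open>L\<close>, which is at most
      \<open>h b\<close>.\<close>
    have "h c \<le> 2 * h (f (Suc n)) - h (f n)" for n
      unfolding f_Suc by (rule g(3)[OF fS c(1) trans[OF b(2) c(2)]])
    moreover have "(\<lambda>n. 2 * h (f (Suc n)) - h (f n)) \<longlonglongrightarrow> 2 * L - L"
      by (intro tendsto_intros L LIMSEQ_Suc[OF L])
    ultimately have "h c \<le> L" by (intro LIMSEQ_le_const[where X="\<lambda>n. 2 * h (f (Suc n)) - h (f n)"]) auto
    moreover have "L \<le> h b" using L hb by (intro LIMSEQ_le_const2) auto
    ultimately show False using c(3) by simp
  qed
  then show ?thesis using b(1) bound by force
qed

section \<open>Seminorm bounds and the metric \<open>rho\<close>\<close>

context separating_seminorms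
begin

lemma zero: "p n 0 = 0"
  using separating[of 0] by blast

text \<open>Terms of \<open>rho\<close> with large index are small by their weight
  \<open>(1/2) ^ n\<close>, whatever \<open>s\<close> is, so only finitely many values of
  \<open>s\<close> restrict \<open>d\<close>. This turns seminorm bounds with a common small factor
  into a bound on the metric.\<close>

lemma rho_small_scale:
  assumes "0 < e"
  shows "\<exists>d>0. \<forall>x y. (\<forall>n. p n (x - y) \<le> d * s n) \<longrightarrow> rho p x y < e"
proof -
  obtain N where N: "(1/2::real) ^ N < e" using real_arch_pow_inv[OF assms, of "1/2"] by auto
  \<comment> \<open>The summand 1 makes \<open>C\<close> positive and strictly larger than every
    \<open>s n\<close> with \<open>n \<le> N\<close>, so that \<open>d = e / C\<close> gives a
    strict bound.\<close>
  define C where "C = 1 + (\<Sum>n\<le>N. \<bar>s n\<bar>)"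
  have C: "1 \<le> C" "\<And>n. n \<le> N \<Longrightarrow> s n < C"
  proof -
    show "1 \<le> C" unfolding C_def by (simp add: sum_nonneg)
    fix n assume "n \<le> N"
    then have "\<bar>s n\<bar> \<le> (\<Sum>n\<le>N. \<bar>s n\<bar>)" by (intro member_le_sum) auto
    then show "s n < C" unfolding C_def by linarith
  qed
  have "rho p x y < e" if le: "\<And>n. p n (x - y) \<le> e / C * s n" for x y
  proof -
    obtain m where m: "rho p x y = (1/2) ^ m * p m (x - y) / (1 + p m (x - y))"
      using rho_attained by blast
    show ?thesis
    proof (cases "m \<le> N")
      case True
      have "rho p x y \<le> p m (x - y)"
      proof -
        have "(1/2) ^ m * p m (x - y) \<le> 1 * p m (x - y)"
          by (intro mult_right_mono power_le_one nonneg) auto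
        also have "\<dots> \<le> p m (x - y) * (1 + p m (x - y))"
          using nonneg[of m "x - y"] by (simp add: algebra_simps)
        finally show ?thesis
          unfolding m using nonneg[of m "x - y"] by (simp add: pos_divide_le_eq)
      qed
      also have "\<dots> \<le> e / C * s m" by (rule le)
      also have "\<dots> < e / C * C" using C assms True by (intro mult_strict_left_mono) auto
      also have "\<dots> = e" using C by simp
      finally show ?thesis .
    next
      case False
      have "rho p x y \<le> (1/2) ^ m" unfolding m by (rule rho_term_le)
      also have "\<dots> \<le> (1/2) ^ N" using False by (intro power_decreasing) auto
      finally show ?thesis using N by simp
    qed
  qed
  then show ?thesis using C assms by (intro exI[of _ "e / C"]) auto
qed

text \<open>Up to the factor \<open>2 ^ k\<close>, \<open>rho\<close> dominates
  \<open>a = u / (1 + u)\<close>, where \<open>u\<close> is the \<open>k\<close>-th seminorm; the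
  inverse map \<open>a / (1 - a)\<close> is continuous at 0.\<close>

lemma tendsto_rho_imp_tendsto_seminorm:
  assumes "(\<lambda>n. rho p (f n) x) \<longlonglongrightarrow> 0"
  shows "(\<lambda>n. p k (f n - x)) \<longlonglongrightarrow> 0"
proof -
  define a where "a n = p k (f n - x) / (1 + p k (f n - x))" for n
  have nn: "0 \<le> p k (f n - x)" for n by (rule nonneg)
  have "a n \<le> 2 ^ k * rho p (f n) x" for n
    using mult_left_mono[OF rho_ge[of k "f n" x], of "2 ^ k"]
    unfolding a_def by (simp add: power_one_over)
  moreover have "0 \<le> a n" for n unfolding a_def using nn[of n] by simp
  moreover have "(\<lambda>n. 2 ^ k * rho p (f n) x) \<longlonglongrightarrow> 0"
    using tendsto_mult_left[OF assms, of "2 ^ k"] by simp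
  ultimately have "a \<longlonglongrightarrow> 0"
    by (intro tendsto_sandwich[of "\<lambda>_. 0" a _ "\<lambda>n. 2 ^ k * rho p (f n) x"]) auto
  then have "(\<lambda>n. a n / (1 - a n)) \<longlonglongrightarrow> 0 / (1 - 0)"
    by (intro tendsto_intros) auto
  moreover have "a n / (1 - a n) = p k (f n - x)" for n
    unfolding a_def using nn[of n] by (simp add: field_simps)
  ultimately show ?thesis by simp
qed

text \<open>\<open>rho\<close> is not homogeneous, so continuity in the scalar comes from the
  seminorms: each seminorm of the difference is \<open>\<bar>t n - l\<bar> * p k w\<close>, with a
  small factor common to all \<open>k\<close>.\<close>

lemma tendsto_rho_scale:
  assumes "t \<longlonglongrightarrow> l"
  shows "(\<lambda>n. rho p (t n *\<^sub>R w) (l *\<^sub>R w)) \<longlonglongrightarrow> 0"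
proof (rule LIMSEQ_I)
  fix e :: real assume "0 < e"
  then obtain d where d: "0 < d" "\<And>x y. (\<And>n. p n (x - y) \<le> d * p n w) \<Longrightarrow> rho p x y < e"
    using rho_small_scale[of e "\<lambda>n. p n w"] by blast
  obtain N where N: "\<And>n. n \<ge> N \<Longrightarrow> norm (t n - l) < d" using LIMSEQ_D[OF assms d(1)] by blast
  have "norm (rho p (t n *\<^sub>R w) (l *\<^sub>R w) - 0) < e" if "n \<ge> N" for n
  proof -
    have "rho p (t n *\<^sub>R w) (l *\<^sub>R w) < e"
    proof (rule d(2))
      fix k
      have "p k (t n *\<^sub>R w - l *\<^sub>R w) = \<bar>t n - l\<bar> * p k w"
        by (simp add: scale flip: scaleR_diff_left)
      also have "\<dots> \<le> d * p k w" using N[OF that] by (intro mult_right_mono nonneg) auto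
      finally show "p k (t n *\<^sub>R w - l *\<^sub>R w) \<le> d * p k w" .
    qed
    moreover have "0 \<le> rho p (t n *\<^sub>R w) (l *\<^sub>R w)"
      using metric_rho by (rule Metric_space.nonneg)
    ultimately show ?thesis by simp
  qed
  then show "\<exists>N. \<forall>n\<ge>N. norm (rho p (t n *\<^sub>R w) (l *\<^sub>R w) - 0) < e" by blast
qed

lemma limitin_iff_rho: "limitin (frechet_topology p) f x sequentially \<longleftrightarrow> (\<lambda>n. rho p (f n) x) \<longlonglongrightarrow> 0"
  using Metric_space.limitin_metric_dist_null[OF metric_rho] by auto

text \<open>Compactness of the parameter interval gives a uniform tube: if points outside
  \<open>V\<close> came arbitrarily close to the segment, a subsequence of their parameters would
  converge to some \<open>l\<close>, and these points would enter a ball around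
  \<open>y + l *\<^sub>R w\<close> that lies in \<open>V\<close>.\<close>

lemma segment_neighbourhood:
  assumes "openin (frechet_topology p) V" and "\<And>t. 0 \<le> t \<Longrightarrow> t \<le> 1 \<Longrightarrow> y + t *\<^sub>R w \<in> V"
  shows "\<exists>e>0. \<forall>t z. 0 \<le> t \<longrightarrow> t \<le> 1 \<longrightarrow> rho p z (y + t *\<^sub>R w) \<le> e \<longrightarrow> z \<in> V"
proof (rule ccontr)
  interpret M: Metric_space UNIV "rho p" by (rule metric_rho)
  assume "\<not> ?thesis"
  then have "\<exists>t z. 0 \<le> t \<and> t \<le> 1 \<and> rho p z (y + t *\<^sub>R w) \<le> inverse (real (Suc n)) \<and> z \<notin> V" for n
    by (metis inverse_positive_iff_positive of_nat_0_less_iff zero_less_Suc)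
  then obtain t z where tz: "\<And>n. 0 \<le> t n" "\<And>n. t n \<le> 1"
    "\<And>n. rho p (z n) (y + t n *\<^sub>R w) \<le> inverse (real (Suc n))" "\<And>n. z n \<notin> V"
    by metis
  have "seq_compact {0..1::real}" by (simp add: compact_imp_seq_compact)
  then obtain l r where lr: "l \<in> {0..1}" "strict_mono r" "(t \<circ> r) \<longlonglongrightarrow> l"
    using tz(1,2) unfolding seq_compact_def by (metis atLeastAtMost_iff)
  obtain e where e: "0 < e" "M.mball (y + l *\<^sub>R w) e \<subseteq> V"
    using assms lr(1) unfolding M.openin_mtopology by (metis atLeastAtMost_iff)
  have "(\<lambda>n. inverse (real (Suc (r n))) + rho p ((t \<circ> r) n *\<^sub>R w) (l *\<^sub>R w)) \<longlonglongrightarrow> 0 + 0"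
    using LIMSEQ_subseq_LIMSEQ[OF LIMSEQ_inverse_real_of_nat lr(2)] tendsto_rho_scale[OF lr(3)]
    by (intro tendsto_add) (auto simp: o_def)
  then have "\<forall>\<^sub>F n in sequentially. inverse (real (Suc (r n))) + rho p ((t \<circ> r) n *\<^sub>R w) (l *\<^sub>R w) < e"
    using e(1) by (intro order_tendstoD(2)) auto
  then obtain n where n: "inverse (real (Suc (r n))) + rho p (t (r n) *\<^sub>R w) (l *\<^sub>R w) < e"
    by (auto simp: eventually_sequentially)
  have "rho p (z (r n)) (y + l *\<^sub>R w)
      \<le> rho p (z (r n)) (y + t (r n) *\<^sub>R w) + rho p (y + t (r n) *\<^sub>R w) (y + l *\<^sub>R w)"
    by (rule M.triangle) auto
  also have "rho p (y + t (r n) *\<^sub>R w) (y + l *\<^sub>R w) = rho p (t (r n) *\<^sub>R w) (l *\<^sub>R w)"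
    by (simp add: rho_def)
  finally have "z (r n) \<in> M.mball (y + l *\<^sub>R w) e"
    using tz(3)[of "r n"] n by (simp add: M.commute)
  then show False using e(2) tz(4) by blast
qed

end

section \<open>Convergence from completeness, and limits in the graph\<close>

context frechet_space
begin

lemma convergent_if_tails_close:
  assumes "\<And>e. 0 < e \<Longrightarrow> \<exists>N. \<forall>m n. N \<le> m \<longrightarrow> m \<le> n \<longrightarrow> rho p (f m) (f n) < e"
  shows "\<exists>x. limitin (frechet_topology p) f x sequentially"
proof -
  interpret M: Metric_space UNIV "rho p" by (rule metric_rho)
  have "M.MCauchy f"
    unfolding M.MCauchy_def
  proof (intro conjI allI impI)
    fix e :: real assume "0 < e"
    then obtain N where N: "\<And>m n. N \<le> m \<Longrightarrow> m \<le> n \<Longrightarrow> rho p (f m) (f n) < e"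
      using assms by blast
    have "rho p (f n) (f n') < e" if "N \<le> n" "N \<le> n'" for n n'
      using N[of n n'] N[of n' n] that by (cases "n \<le> n'") (auto simp: M.commute)
    then show "\<exists>N. \<forall>n n'. N \<le> n \<longrightarrow> N \<le> n' \<longrightarrow> rho p (f n) (f n') < e" by blast
  qed auto
  then show ?thesis using complete unfolding M.mcomplete_def by blast
qed

lemma convergent_if_rho_le:
  assumes "\<And>m n. m \<le> n \<Longrightarrow> rho p (f m) (f n) \<le> r m" and "r \<longlonglongrightarrow> 0"
  shows "\<exists>x. limitin (frechet_topology p) f x sequentially"
proof (rule convergent_if_tails_close)
  fix e :: real assume "0 < e"
  then have "\<forall>\<^sub>F n in sequentially. r n < e"
    using assms(2) by (intro order_tendstoD(2)) auto
  then obtain N where "\<And>n. N \<le> n \<Longrightarrow> r n < e"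
    by (auto simp: eventually_sequentially)
  then show "\<exists>N. \<forall>m n. N \<le> m \<longrightarrow> m \<le> n \<longrightarrow> rho p (f m) (f n) < e"
    using le_less_trans[OF assms(1)] by blast
qed

text \<open>Convergence of \<open>t\<close> makes the factors \<open>t n - t m\<close> small for all
  \<open>k\<close> at once, which is what \<open>rho_small_scale\<close> needs to bound the metric.
  It serves the first components of an increasing sequence of states.\<close>

lemma convergent_if_seminorm_le:
  assumes le: "\<And>m n k. m \<le> n \<Longrightarrow> p k (f n - f m) \<le> (t n - t m) * s k"
    and lim: "t \<longlonglongrightarrow> l"
  shows "\<exists>x. limitin (frechet_topology p) f x sequentially"
proof (rule convergent_if_tails_close)
  fix e :: real assume "0 < e"
  then obtain d where d: "0 < d" "\<And>x y. (\<And>n. p n (x - y) \<le> d * \<bar>s n\<bar>) \<Longrightarrow> rho p x y < e"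
    using rho_small_scale[of e "\<lambda>n. \<bar>s n\<bar>"] by blast
  obtain N where N: "\<And>m n. m \<ge> N \<Longrightarrow> n \<ge> N \<Longrightarrow> norm (t m - t n) < d"
    using CauchyD[OF LIMSEQ_imp_Cauchy[OF lim] d(1)] by blast
  have "rho p (f m) (f n) < e" if "N \<le> m" "m \<le> n" for m n
  proof (rule d(2))
    fix k
    have "p k (f m - f n) \<le> (t n - t m) * s k" using le[OF that(2)] by (simp add: minus_commute)
    also have "\<dots> \<le> \<bar>t n - t m\<bar> * \<bar>s k\<bar>" by (metis abs_ge_self abs_mult)
    also have "\<dots> \<le> d * \<bar>s k\<bar>" using N[of n m] that by (intro mult_right_mono) auto
    finally show "p k (f m - f n) \<le> d * \<bar>s k\<bar>" .
  qed
  then show "\<exists>N. \<forall>m n. N \<le> m \<longrightarrow> m \<le> n \<longrightarrow> rho p (f m) (f n) < e" by blast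
qed

end

lemma limit_in_graph:
  assumes "closedin (prod_topology (frechet_topology p) (frechet_topology q)) (Gr F)"
    and "\<And>n. g n \<in> F (f n)"
    and "limitin (frechet_topology p) f x sequentially"
    and "limitin (frechet_topology q) g y sequentially"
  shows "y \<in> F x"
proof -
  have "limitin (prod_topology (frechet_topology p) (frechet_topology q))
          (\<lambda>n. (f n, g n)) (x, y) sequentially"
    using assms(3,4) by (simp add: limitin_pairwise o_def)
  then have "(x, y) \<in> Gr F"
    using assms(1,2) by (intro limitin_closedin) (auto simp: Gr_def)
  then show ?thesis by (simp add: Gr_def)
qed

section \<open>Reaching the end of the segment by steps\<close>

text \<open>The lengths of successive steps may sum to less than the remaining time, so finite or
  countable iteration alone need not arrive at time 1. Completeness and the closed graph supply
  limit states from which one can step again, and the ordering principle does the rest. All bounds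
  are proportional to elapsed time, so the total error stays within \<open>e\<close>.\<close>

lemma approximate_segment_endpoint:
  fixes p :: "nat \<Rightarrow> 'a::real_vector \<Rightarrow> real" and q :: "nat \<Rightarrow> 'b::real_vector \<Rightarrow> real"
  assumes fp: "frechet_space p" and fq: "frechet_space q"
    and closed: "closedin (prod_topology (frechet_topology p) (frechet_topology q)) (Gr F)"
    and e: "0 \<le> e" and y0: "y0 \<in> F x0"
    and step: "\<And>\<tau> x y. 0 \<le> \<tau> \<Longrightarrow> \<tau> < 1 \<Longrightarrow> y \<in> F x \<Longrightarrow> (\<And>k. p k (x - x0) \<le> \<tau> * s k) \<Longrightarrow>
        rho q y (y0 + \<tau> *\<^sub>R w) \<le> \<tau> * e \<Longrightarrow>
        \<exists>t x' y'. 0 < t \<and> t \<le> 1 - \<tau> \<and> y' \<in> F x' \<and> (\<forall>k. p k (x' - x) \<le> t * s k) \<and>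
          rho q y' (y + t *\<^sub>R w) \<le> t * e"
  shows "\<exists>x y. y \<in> F x \<and> (\<forall>k. p k (x - x0) \<le> s k) \<and> rho q y (y0 + w) \<le> e"
proof -
  interpret X: frechet_space p by fact
  interpret Y: frechet_space q by fact
  interpret M: Metric_space UNIV "rho q" by (rule Y.metric_rho)
  \<comment> \<open>\<open>R\<close> relates two states when the move between them obeys the bounds
    for the elapsed time \<open>t' - t\<close>; linearity of these bounds in time is what makes
    \<open>R\<close> transitive. \<open>S\<close> consists of the states reached from the start by
    time 1.\<close>
  define R :: "real \<times> 'a \<times> 'b \<Rightarrow> real \<times> 'a \<times> 'b \<Rightarrow> bool" where
    "R = (\<lambda>(t, x, y) (t', x', y'). t \<le> t' \<and> (\<forall>k. p k (x' - x) \<le> (t' - t) * s k) \<and>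
            rho q y' (y + (t' - t) *\<^sub>R w) \<le> (t' - t) * e)"
  define S where "S = {(t, x, y). t \<le> 1 \<and> y \<in> F x \<and> R (0, x0, y0) (t, x, y)}"
  have R_refl: "R a a" for a
    by (cases a) (simp add: R_def X.zero)
  have R_trans: "R a c" if "R a b" "R b c" for a b c
  proof -
    obtain t x y t' x' y' t'' x'' y'' where
      [simp]: "a = (t, x, y)" "b = (t', x', y')" "c = (t'', x'', y'')"
      by (metis prod_cases3)
    have "p k (x'' - x) \<le> (t'' - t) * s k" for k
    proof -
      have "p k (x'' - x) \<le> p k (x'' - x') + p k (x' - x)"
        using X.triangle[of k "x'' - x'" "x' - x"] by simp
      also have "\<dots> \<le> (t'' - t') * s k + (t' - t) * s k"
        using that by (intro add_mono) (auto simp: R_def)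
      finally show ?thesis by (simp add: algebra_simps)
    qed
    moreover have "rho q y'' (y + (t'' - t) *\<^sub>R w) \<le> (t'' - t) * e"
    proof -
      \<comment> \<open>\<open>rho\<close> depends only on the difference of its arguments, so the
        common shift by \<open>(t'' - t') *\<^sub>R w\<close> cancels.\<close>
      have "rho q (y' + (t'' - t') *\<^sub>R w) (y + (t'' - t) *\<^sub>R w) = rho q y' (y + (t' - t) *\<^sub>R w)"
        by (simp add: rho_def algebra_simps)
      then have "rho q y'' (y + (t'' - t) *\<^sub>R w)
          \<le> rho q y'' (y' + (t'' - t') *\<^sub>R w) + rho q y' (y + (t' - t) *\<^sub>R w)"
        using M.triangle[of y'' "y' + (t'' - t') *\<^sub>R w" "y + (t'' - t) *\<^sub>R w"] by simp
      also have "\<dots> \<le> (t'' - t') * e + (t' - t) * e"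
        using that by (intro add_mono) (auto simp: R_def)
      finally show ?thesis by (simp add: algebra_simps)
    qed
    ultimately show ?thesis using that by (auto simp: R_def)
  qed
  have "\<exists>b\<in>S. fst b = 1"
  \<comment> \<open>The quantity to be raised is the time coordinate \<open>fst\<close>, with bound
    1.\<close>
  proof (rule brezis_browder[where R = R and ?a0.0 = "(0, x0, y0)"])
    show "fst a \<le> fst b" if "R a b" for a b
      using that by (auto simp: R_def)
    show "(0, x0, y0) \<in> S"
      using y0 R_refl by (simp add: S_def)
    show "\<exists>b\<in>S. R a b \<and> fst a < fst b" if a: "a \<in> S" "fst a < 1" for a
    proof -
      obtain \<tau> x y where [simp]: "a = (\<tau>, x, y)" by (metis prod_cases3)
      have S: "y \<in> F x" "R (0, x0, y0) (\<tau>, x, y)" using a by (auto simp: S_def)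
      then obtain t x' y' where t: "0 < t" "t \<le> 1 - \<tau>" "y' \<in> F x'"
        "\<forall>k. p k (x' - x) \<le> t * s k" "rho q y' (y + t *\<^sub>R w) \<le> t * e"
        using step[of \<tau> y x] a(2) by (auto simp: R_def)
      then have "R a (\<tau> + t, x', y')" by (simp add: R_def)
      then show ?thesis
        using t R_trans[OF S(2)] by (intro bexI[of _ "(\<tau> + t, x', y')"]) (auto simp: S_def)
    qed
    show "\<exists>b\<in>S. \<forall>n. R (f n) b" if f: "\<And>n. f n \<in> S" "\<And>n. R (f n) (f (Suc n))" for f
    proof -
      define t x y where "t n = fst (f n)" and "x n = fst (snd (f n))" and "y n = snd (snd (f n))" for n
      have f_eq: "f n = (t n, x n, y n)" for n by (simp add: t_def x_def y_def)
      have Rmn: "R (t m, x m, y m) (t n, x n, y n)" if "m \<le> n" for m n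
        using that unfolding f_eq[symmetric]
        by (induction rule: dec_induct) (auto intro: R_refl R_trans f(2))
      have fS: "t n \<le> 1" "y n \<in> F (x n)" for n using f(1)[of n] by (auto simp: S_def f_eq)
      have "incseq t" using Rmn by (auto simp: R_def incseq_def)
      then obtain l where l: "t \<longlonglongrightarrow> l" "\<And>n. t n \<le> l"
        using incseq_convergent[of t 1] fS(1) by blast
      obtain xl where xl: "limitin (frechet_topology p) x xl sequentially"
        using X.convergent_if_seminorm_le[of x t s l] Rmn l(1) by (auto simp: R_def)
      have y_dist: "rho q (y n) (y m + (t n - t m) *\<^sub>R w) \<le> (t n - t m) * e" if "m \<le> n" for m n
        using Rmn[OF that] by (simp add: R_def)
      obtain yl where yl: "limitin (frechet_topology q) y yl sequentially"
      proof -
        \<comment> \<open>Subtracting the drift \<open>t n *\<^sub>R w\<close> leaves a sequence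
          whose movement is error only, hence Cauchy with limit \<open>z\<close>; putting the drift
          back gives the limit \<open>z + l *\<^sub>R w\<close> of \<open>y\<close>.\<close>
        have "rho q (y m - t m *\<^sub>R w) (y n - t n *\<^sub>R w) \<le> (l - t m) * e" if "m \<le> n" for m n
        proof -
          have "rho q (y m - t m *\<^sub>R w) (y n - t n *\<^sub>R w) = rho q (y n) (y m + (t n - t m) *\<^sub>R w)"
            using M.commute[of "y m - t m *\<^sub>R w" "y n - t n *\<^sub>R w"]
            by (simp add: rho_def algebra_simps)
          also have "\<dots> \<le> (t n - t m) * e" by (rule y_dist[OF that])
          also have "\<dots> \<le> (l - t m) * e" using l(2) e by (intro mult_right_mono) auto
          finally show ?thesis .
        qed
        moreover have "(\<lambda>m. (l - t m) * e) \<longlonglongrightarrow> (l - l) * e" by (intro tendsto_intros l)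
        ultimately obtain z where
          "limitin (frechet_topology q) (\<lambda>n. y n - t n *\<^sub>R w) z sequentially"
          using Y.convergent_if_rho_le[of "\<lambda>n. y n - t n *\<^sub>R w" "\<lambda>m. (l - t m) * e"] by auto
        then have "(\<lambda>n. rho q (y n - t n *\<^sub>R w) z + rho q (t n *\<^sub>R w) (l *\<^sub>R w)) \<longlonglongrightarrow> 0 + 0"
          unfolding Y.limitin_iff_rho using Y.tendsto_rho_scale[OF l(1)] by (rule tendsto_add)
        moreover have "rho q (y n) (z + l *\<^sub>R w)
            \<le> rho q (y n - t n *\<^sub>R w) z + rho q (t n *\<^sub>R w) (l *\<^sub>R w)" for n
          using M.triangle[of "y n" "z + t n *\<^sub>R w" "z + l *\<^sub>R w"]
          by (simp add: rho_def algebra_simps)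
        ultimately have "(\<lambda>n. rho q (y n) (z + l *\<^sub>R w)) \<longlonglongrightarrow> 0"
          by (intro tendsto_sandwich[of "\<lambda>_. 0" "\<lambda>n. rho q (y n) (z + l *\<^sub>R w)" _
                "\<lambda>n. rho q (y n - t n *\<^sub>R w) z + rho q (t n *\<^sub>R w) (l *\<^sub>R w)"]) auto
        then show ?thesis using that Y.limitin_iff_rho by blast
      qed
      have graph: "yl \<in> F xl"
        by (rule limit_in_graph[OF closed fS(2) xl yl])
      have Rl: "R (t m, x m, y m) (l, xl, yl)" for m
      proof -
        have "p k (xl - x m) \<le> (l - t m) * s k" for k
        proof -
          have "p k (xl - x m) \<le> p k (x n - xl) + (t n - t m) * s k" if "n \<ge> m" for n
            using X.triangle[of k "xl - x n" "x n - x m"] Rmn[OF that] X.minus_commute[of k xl "x n"]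
            by (auto simp: R_def) (smt (verit))
          moreover have "(\<lambda>n. p k (x n - xl) + (t n - t m) * s k) \<longlonglongrightarrow> 0 + (l - t m) * s k"
            using xl unfolding X.limitin_iff_rho
            by (intro tendsto_intros X.tendsto_rho_imp_tendsto_seminorm l)
          ultimately show ?thesis
            by (intro LIMSEQ_le_const[where X = "\<lambda>n. p k (x n - xl) + (t n - t m) * s k"]) auto
        qed
        moreover have "rho q yl (y m + (l - t m) *\<^sub>R w) \<le> (l - t m) * e"
        proof -
          \<comment> \<open>The three terms follow a path from \<open>yl\<close> to
            \<open>y n\<close>, then to \<open>y m\<close> moved along \<open>w\<close> up to time
            \<open>t n\<close>, then along \<open>w\<close> up to time \<open>l\<close>. The outer
            terms vanish in the limit.\<close>
          let ?b = "\<lambda>n. rho q (y n) yl + (t n - t m) * e + rho q (t n *\<^sub>R w) (l *\<^sub>R w)"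
          have "rho q yl (y m + (l - t m) *\<^sub>R w) \<le> ?b n" if "n \<ge> m" for n
          proof -
            have "rho q (y m + (t n - t m) *\<^sub>R w) (y m + (l - t m) *\<^sub>R w)
                = rho q (t n *\<^sub>R w) (l *\<^sub>R w)"
              by (simp add: rho_def algebra_simps)
            then show ?thesis
              using M.triangle[of yl "y n" "y m + (l - t m) *\<^sub>R w"] y_dist[OF that]
                M.triangle[of "y n" "y m + (t n - t m) *\<^sub>R w" "y m + (l - t m) *\<^sub>R w"]
                M.commute[of yl "y n"] by simp
          qed
          moreover have "?b \<longlonglongrightarrow> 0 + (l - t m) * e + 0"
            using yl unfolding Y.limitin_iff_rho
            by (intro tendsto_intros Y.tendsto_rho_scale l)
          ultimately show ?thesis
            by (intro LIMSEQ_le_const[where X = ?b]) auto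
        qed
        ultimately show ?thesis using l(2) by (simp add: R_def)
      qed
      moreover have "(l, xl, yl) \<in> S"
      proof -
        have "l \<le> 1" using l(1) fS(1) by (intro LIMSEQ_le_const2) auto
        moreover have "R (0, x0, y0) (t 0, x 0, y 0)" using f(1)[of 0] by (auto simp: S_def f_eq)
        ultimately show ?thesis using graph R_trans[OF _ Rl] by (auto simp: S_def)
      qed
      ultimately show ?thesis by (metis f_eq)
    qed
  qed (auto simp: S_def intro: R_refl R_trans)
  then show ?thesis by (auto simp: S_def R_def)
qed

section \<open>From the derivative condition to approximate solutions\<close>

text \<open>For large \<open>n\<close> the quotient in \<open>D'\<close> is below \<open>e\<close>,
  so the infimum is finite and less than \<open>t n * e\<close>; being strict, this bound is met by
  an actual value of \<open>F\<close>. Since \<open>t\<close> tends to 0, the step can also be made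
  as short as desired.\<close>

lemma D'_imp_step:
  assumes "v \<in> D' q F x y A" and "0 < e" and "0 < r"
  shows "\<exists>t a y'. 0 < t \<and> t \<le> r \<and> a \<in> A \<and> y' \<in> F (x + t *\<^sub>R a) \<and> rho q y' (y + t *\<^sub>R v) < t * e"
proof -
  let ?i = "\<lambda>t. inf_rho q (image_mv F ((\<lambda>a. x + t *\<^sub>R a) ` A)) (y + t *\<^sub>R v)"
  obtain t where t: "\<And>n. 0 < t n" "t \<longlonglongrightarrow> 0" "(\<lambda>n. ?i (t n) / ereal (t n)) \<longlonglongrightarrow> 0"
    using assms(1) unfolding D'_def by blast
  have "\<forall>\<^sub>F n in sequentially. t n < r \<and> ?i (t n) / ereal (t n) < ereal e"
    using assms t by (intro eventually_conj order_tendstoD(2)[of _ 0]) auto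
  then obtain n where n: "t n < r" "?i (t n) / ereal (t n) < ereal e"
    by (auto simp: eventually_sequentially)
  then have "?i (t n) < ereal (t n * e)"
    using t(1)[of n] by (simp add: ereal_divide_less_iff mult.commute)
  then obtain y' where "y' \<in> image_mv F ((\<lambda>a. x + t n *\<^sub>R a) ` A)" "rho q y' (y + t n *\<^sub>R v) < t n * e"
    unfolding inf_rho_def INF_less_iff by auto
  then show ?thesis
    unfolding image_mv_def using n(1) t(1)[of n] by (intro exI[of _ "t n"]) auto
qed

text \<open>With a small enough error per unit of time, every state before time 1 lies in
  \<open>U \<times> V\<close>, so the derivative condition applies there and supplies the next
  step.\<close>

lemma box_approximation:
  fixes p :: "nat \<Rightarrow> 'a::real_vector \<Rightarrow> real" and q :: "nat \<Rightarrow> 'b::real_vector \<Rightarrow> real"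
  assumes fp: "frechet_space p" and fq: "frechet_space q"
    and closed: "closedin (prod_topology (frechet_topology p) (frechet_topology q)) (Gr F)"
    and V: "openin (frechet_topology q) V" "convex V"
    and deriv: "\<forall>(x, y) \<in> (U \<times> V) \<inter> Gr F. \<forall>s\<in>nonneg_seqs.
           (\<lambda>v. \<kappa> *\<^sub>R v) ` Pi_box q s \<subseteq> D' q F x y (Pi_box p s)"
    and s: "s \<in> nonneg_seqs" and xy: "(x, y) \<in> (U \<times> V) \<inter> Gr F"
    and U: "(\<lambda>a. x + a) ` Pi_box p s \<subseteq> U"
    and z: "z \<in> (\<lambda>v. y + \<kappa> *\<^sub>R v) ` Pi_box q s \<inter> V" and e: "0 < e"
  shows "\<exists>a\<in>Pi_box p s. \<exists>y'\<in>F (x + a). rho q y' z < e"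
proof -
  interpret X: frechet_space p by fact
  interpret Y: frechet_space q by fact
  obtain v where v: "v \<in> Pi_box q s" "z = y + \<kappa> *\<^sub>R v" using z by blast
  \<comment> \<open>Both endpoints \<open>y\<close> and \<open>z\<close> of the segment lie in
    \<open>V\<close>, so convexity keeps the whole segment there.\<close>
  have "y + t *\<^sub>R (\<kappa> *\<^sub>R v) \<in> V" if "0 \<le> t" "t \<le> 1" for t
    using convexD_alt[OF V(2), of y z t] xy z that unfolding v(2)
    by (simp add: algebra_simps)
  then obtain e' where e': "0 < e'"
    "\<And>t y'. 0 \<le> t \<Longrightarrow> t \<le> 1 \<Longrightarrow> rho q y' (y + t *\<^sub>R (\<kappa> *\<^sub>R v)) \<le> e' \<Longrightarrow> y' \<in> V"
    using Y.segment_neighbourhood[OF V(1)] by blast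
  \<comment> \<open>\<open>e'\<close> keeps the second components in \<open>V\<close>; the half of
    \<open>e\<close> turns the non-strict final bound into a strict one.\<close>
  define d where "d = min e' (e / 2)"
  have d: "0 < d" "d \<le> e'" "d < e" using e e' by (auto simp: d_def)
  have "\<exists>x' y'. y' \<in> F x' \<and> (\<forall>k. p k (x' - x) \<le> s k) \<and> rho q y' (y + \<kappa> *\<^sub>R v) \<le> d"
  proof (rule approximate_segment_endpoint[OF fp fq closed])
    show "0 \<le> d" "y \<in> F x" using d xy by (auto simp: Gr_def)
    fix \<tau> x' y'
    assume \<tau>: "0 \<le> \<tau>" "\<tau> < 1" and y': "y' \<in> F x'" and x': "\<And>k. p k (x' - x) \<le> \<tau> * s k"
      and r: "rho q y' (y + \<tau> *\<^sub>R \<kappa> *\<^sub>R v) \<le> \<tau> * d"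
    \<comment> \<open>As \<open>s\<close> is nonnegative, the box scaled by \<open>\<tau>\<close>
      lies in the full box, whose translate by \<open>x\<close> is contained in
      \<open>U\<close>.\<close>
    have "\<tau> * s k \<le> 1 * s k" for k
      using \<tau> s by (intro mult_right_mono) (auto simp: nonneg_seqs_def)
    then have "x' - x \<in> Pi_box p s" using x' order_trans by (fastforce simp: Pi_box_def)
    then have "x + (x' - x) \<in> U" using U by blast
    then have "x' \<in> U" by simp
    moreover have "\<tau> * d \<le> 1 * d" using \<tau> d by (intro mult_right_mono) auto
    then have "rho q y' (y + \<tau> *\<^sub>R \<kappa> *\<^sub>R v) \<le> e'" using r d by linarith
    then have "y' \<in> V" using \<tau> by (intro e'(2)[of \<tau> y']) auto
    ultimately have "\<kappa> *\<^sub>R v \<in> D' q F x' y' (Pi_box p s)"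
      using deriv s v(1) y' by (fastforce simp: Gr_def)
    \<comment> \<open>The length limit \<open>1 - \<tau>\<close> prevents the step from overshooting
      the endpoint.\<close>
    then obtain t a y'' where t: "0 < t" "t \<le> 1 - \<tau>" "a \<in> Pi_box p s" "y'' \<in> F (x' + t *\<^sub>R a)"
      "rho q y'' (y' + t *\<^sub>R \<kappa> *\<^sub>R v) < t * d"
      using D'_imp_step[of "\<kappa> *\<^sub>R v" q F x' y' "Pi_box p s" d "1 - \<tau>"] d \<tau> by auto
    then show "\<exists>t x'' y''. 0 < t \<and> t \<le> 1 - \<tau> \<and> y'' \<in> F x'' \<and> (\<forall>k. p k (x'' - x') \<le> t * s k) \<and>
        rho q y'' (y' + t *\<^sub>R \<kappa> *\<^sub>R v) \<le> t * d"
      by (intro exI[of _ t] exI[of _ "x' + t *\<^sub>R a"] exI[of _ y''])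
        (auto simp: X.scale Pi_box_def intro: mult_left_mono)
  qed
  then obtain x' y' where "y' \<in> F x'" "\<forall>k. p k (x' - x) \<le> s k" "rho q y' z \<le> d"
    unfolding v(2) by blast
  then show ?thesis
    using d by (intro bexI[of _ "x' - x"] bexI[of _ y']) (auto simp: Pi_box_def)
qed

section \<open>Weak surjectivity, and surjectivity from compactness\<close>

theorem theorem7:
  fixes p :: "nat \<Rightarrow> 'a::real_vector \<Rightarrow> real"
    and q :: "nat \<Rightarrow> 'b::real_vector \<Rightarrow> real"
    and F :: "'a \<Rightarrow> 'b set" and U :: "'a set" and V :: "'b set" and \<kappa> :: real
  assumes "frechet_space p" and "frechet_space q"
    and "closedin (prod_topology (frechet_topology p) (frechet_topology q)) (Gr F)"
    and "openin (frechet_topology p) U"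
    and "openin (frechet_topology q) V" and "convex V"
    and "0 < \<kappa>"
    and "\<forall>(x, y) \<in> (U \<times> V) \<inter> Gr F. \<forall>s\<in>nonneg_seqs.
           (\<lambda>v. \<kappa> *\<^sub>R v) ` Pi_box q s \<subseteq> D' q F x y (Pi_box p s)"
  shows "weakly_Pi_surjective p q F U V \<kappa> \<and>
    ((\<forall>s\<in>nonneg_seqs. compactin (frechet_topology p) (Pi_box p s)) \<longrightarrow>
      Pi_surjective p q F U V \<kappa>)"
proof (intro conjI impI)
  interpret X: frechet_space p by fact
  interpret Y: frechet_space q by fact
  interpret MX: Metric_space UNIV "rho p" by (rule X.metric_rho)
  interpret MY: Metric_space UNIV "rho q" by (rule Y.metric_rho)
  note approx = box_approximation[OF assms(1-3,5,6,8)]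
  show "weakly_Pi_surjective p q F U V \<kappa>"
    unfolding weakly_Pi_surjective_def
  proof (intro conjI allI ballI impI subsetI \<open>0 < \<kappa>\<close>)
    fix x y s z
    assume *: "s \<in> nonneg_seqs"
      "(x, y) \<in> (U \<times> V) \<inter> Gr F \<and> (\<lambda>a. x + a) ` Pi_box p s \<subseteq> U"
      "z \<in> (\<lambda>v. y + \<kappa> *\<^sub>R v) ` Pi_box q s \<inter> V"
    have "\<exists>y'\<in>image_mv F ((\<lambda>a. x + a) ` Pi_box p s). y' \<in> MY.mball z e" if "0 < e" for e
      using approx[OF *(1) conjunct1[OF *(2)] conjunct2[OF *(2)] *(3) that]
      by (auto simp: image_mv_def MY.commute)
    then show "z \<in> frechet_topology q closure_of image_mv F ((\<lambda>a. x + a) ` Pi_box p s)"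
      unfolding MY.metric_closure_of by simp
  qed
  assume compact: "\<forall>s\<in>nonneg_seqs. compactin (frechet_topology p) (Pi_box p s)"
  show "Pi_surjective p q F U V \<kappa>"
    unfolding Pi_surjective_def
  proof (intro conjI allI ballI impI subsetI \<open>0 < \<kappa>\<close>)
    fix x y s z
    assume *: "s \<in> nonneg_seqs"
      "(x, y) \<in> (U \<times> V) \<inter> Gr F \<and> (\<lambda>a. x + a) ` Pi_box p s \<subseteq> U"
      "z \<in> (\<lambda>v. y + \<kappa> *\<^sub>R v) ` Pi_box q s \<inter> V"
    \<comment> \<open>Approximate with errors tending to 0. Compactness of the box gives a
      convergent subsequence of the \<open>a n\<close>, and the closed graph makes \<open>z\<close>
      a value of \<open>F\<close> at the limit.\<close>
    have "\<exists>a y'. a \<in> Pi_box p s \<and> y' \<in> F (x + a) \<and> rho q y' z < inverse (real (Suc n))" for n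
      using approx[OF *(1) conjunct1[OF *(2)] conjunct2[OF *(2)] *(3), of "inverse (real (Suc n))"]
      by auto
    then obtain a g where ag: "\<And>n. a n \<in> Pi_box p s" "\<And>n. g n \<in> F (x + a n)"
      "\<And>n. rho q (g n) z < inverse (real (Suc n))"
      by metis
    obtain l r where lr: "l \<in> Pi_box p s" "strict_mono r"
      "limitin (frechet_topology p) (a \<circ> r) l sequentially"
      using compact * ag(1) unfolding MX.compactin_sequentially by (metis image_subsetI)
    have "(\<lambda>n. rho q (g n) z) \<longlonglongrightarrow> 0"
    proof (rule tendsto_sandwich[OF _ _ tendsto_const LIMSEQ_inverse_real_of_nat])
      show "\<forall>\<^sub>F n in sequentially. 0 \<le> rho q (g n) z" by simp
      show "\<forall>\<^sub>F n in sequentially. rho q (g n) z \<le> inverse (real (Suc n))"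
        using ag(3) by (intro always_eventually allI less_imp_le)
    qed
    then have gr: "limitin (frechet_topology q) (g \<circ> r) z sequentially"
      unfolding Y.limitin_iff_rho using LIMSEQ_subseq_LIMSEQ[OF _ lr(2)] by (simp add: o_def)
    have ar: "limitin (frechet_topology p) (\<lambda>n. x + (a \<circ> r) n) (x + l) sequentially"
      using lr(3) unfolding X.limitin_iff_rho by (simp add: rho_def)
    have "z \<in> F (x + l)"
      by (rule limit_in_graph[OF assms(3) _ ar gr]) (simp add: ag(2))
    then show "z \<in> image_mv F ((\<lambda>a. x + a) ` Pi_box p s)"
      using lr(1) by (auto simp: image_mv_def)
  qed
qed

end
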